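(* We have $$\mathrm{tot}_n(121)=\frac{(n+1)3^{n-3}+n-3}{4}, \qquad n \geq 2,$$ and $$f_n(121)=\sum_{j=1}^n\sum_{p=0}^{\lfloor \frac{j-1}{2}\rfloor}\sum_{r=0}^p\binom{p}{r}\binom{j-p-1}{2p-r}\binom{n-r-1}{j-1}, \qquad n \geq 1.$$
   Context: A Catalan word of length $n\geq 1$ is an integer sequence $\pi=\pi_1\cdots\pi_n$ with $\pi_1=1$ and $1\leq \pi_{i+1}\leq \pi_i+1$ for $1\leq i\leq n-1$. A (weakly) increasing run of a word is a maximal nondecreasing string of consecutive letters. A Catalan word is flattened if the sequence of first letters of its increasing runs, read from left to right, is nondecreasing. $\mathcal{F}_n$ is the set of flattened Catalan words of length $n$. An occurrence of a pattern $\tau=\tau_1\cdots\tau_m$ in $\pi$ as a consecutive (subword) pattern is an index $i$ such that $\pi_i\pi_{i+1}\cdots\pi_{i+m-1}$ is order-isomorphic to $\tau$; $\pi$ avoids $\tau$ if it has no occurrence of $\tau$. $\mathrm{tot}_n(\tau)$ denotes the total number of occurrences of $\tau$ in all the members of $\mathcal{F}_n$, and $f_n(\tau)$ denotes the number of members of $\mathcal{F}_n$ that avoid $\tau$. Binomial coefficients $\binom{a}{b}$ with $0\leq a<b$ are zero. *)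

theory Defs
  imports Complex_Main
begin

text \<open>Words are lists of natural numbers; list positions are counted from 0, so that
  the letter \<open>\<pi>\<^sub>i\<close> of the mathematical notation is \<open>w ! (i - 1)\<close>.\<close>

definition catalan_word :: "nat list \<Rightarrow> bool" where
  "catalan_word w \<longleftrightarrow> w \<noteq> [] \<and> w ! 0 = 1 \<and>
     (\<forall>i. Suc i < length w \<longrightarrow> 1 \<le> w ! Suc i \<and> w ! Suc i \<le> w ! i + 1)"

text \<open>The string of consecutive letters at the positions \<open>i, \<dots>, j\<close> (both inclusive).\<close>

definition segment :: "'a list \<Rightarrow> nat \<Rightarrow> nat \<Rightarrow> 'a list" where
  "segment w i j = take (Suc j - i) (drop i w)"

definition increasing_run :: "nat list \<Rightarrow> nat \<Rightarrow> nat \<Rightarrow> bool" where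
  "increasing_run w i j \<longleftrightarrow> i \<le> j \<and> j < length w \<and> sorted (segment w i j) \<and>
     (\<forall>i' j'. i' \<le> i \<and> j \<le> j' \<and> j' < length w \<and> sorted (segment w i' j')
        \<longrightarrow> i' = i \<and> j' = j)"

definition flattened :: "nat list \<Rightarrow> bool" where
  "flattened w \<longleftrightarrow>
     (\<forall>i j k l. increasing_run w i j \<and> increasing_run w k l \<and> i < k \<longrightarrow> w ! i \<le> w ! k)"

definition flattened_catalan_words :: "nat \<Rightarrow> nat list set" where
  "flattened_catalan_words n = {w. length w = n \<and> catalan_word w \<and> flattened w}"

text \<open>Equivalence of the strict comparisons for all ordered pairs of positions also forces
  equal letters of one word to correspond to equal letters of the other.\<close>

definition order_isomorphic :: "nat list \<Rightarrow> nat list \<Rightarrow> bool" where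
  "order_isomorphic u v \<longleftrightarrow> length u = length v \<and>
     (\<forall>a < length u. \<forall>b < length u. u ! a < u ! b \<longleftrightarrow> v ! a < v ! b)"

definition occurrences :: "nat list \<Rightarrow> nat list \<Rightarrow> nat set" where
  "occurrences \<tau> w =
     {i. i + length \<tau> \<le> length w \<and> order_isomorphic (take (length \<tau>) (drop i w)) \<tau>}"

definition avoids :: "nat list \<Rightarrow> nat list \<Rightarrow> bool" where
  "avoids w \<tau> \<longleftrightarrow> occurrences \<tau> w = {}"

definition tot :: "nat \<Rightarrow> nat list \<Rightarrow> nat" where
  "tot n \<tau> = (\<Sum>w \<in> flattened_catalan_words n. card (occurrences \<tau> w))"

definition num_avoiding :: "nat \<Rightarrow> nat list \<Rightarrow> nat" where
  "num_avoiding n \<tau> = card {w \<in> flattened_catalan_words n. avoids w \<tau>}"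

end

theory Submission
  imports Defs "HOL-Computational_Algebra.Formal_Power_Series"
begin

text \<open>A flattened Catalan word \<open>w\<close> is extended on the right by a letter \<open>x\<close> as follows. Let \<open>h\<close> be the
first letter of its last run and \<open>l\<close> its last letter, so that \<open>h \<le> l\<close>. A letter \<open>x \<ge> l\<close> continues
the run and must be \<open>l\<close> or \<open>l + 1\<close>; a letter \<open>x < l\<close> starts a new run and must satisfy \<open>h \<le> x\<close>.
Hence the children of \<open>w\<close> are exactly the words \<open>w @ [x]\<close> with \<open>h \<le> x \<le> l + 1\<close>. Up to
a shift they depend on the slack \<open>d = l - h\<close> alone: the child for \<open>x = l\<close> has slack \<open>d\<close>, that for
\<open>x = l + 1\<close> has slack \<open>d + 1\<close>, and the other \<open>d\<close> children have slack \<open>0\<close>.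

In a Catalan word an occurrence of \<open>121\<close> is a string \<open>a (a + 1) a\<close>. So a child has
one occurrence more than \<open>w\<close> precisely when \<open>w\<close> ends in an ascent and \<open>x = l - 1\<close>. Weight each word by
\<open>q\<close> to the number of its occurrences, and let \<open>M\<^sub>n(q)\<close> and \<open>D\<^sub>n(q)\<close> be the sums over the words of
length \<open>n\<close> of the weight and of slack times weight. Each word has exactly one child that ends in
an ascent, and that child has the same weight; so the words of length \<open>n + 1\<close> ending in an ascent
have total weight \<open>M\<^sub>n(q)\<close>. As the numbers of children and their slacks are linear in \<open>d\<close>, the two sums
satisfy a closed linear system (lemmas \<open>weight_sum_Suc_Suc\<close> and \<open>slack_sum_Suc\<close>):
\<open>M\<^sub>n\<^sub>+\<^sub>2 = 2 M\<^sub>n\<^sub>+\<^sub>1 + D\<^sub>n\<^sub>+\<^sub>1 + (q - 1) M\<^sub>n\<close> and \<open>D\<^sub>n\<^sub>+\<^sub>1 = 2 D\<^sub>n + M\<^sub>n\<close>.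

The total number of occurrences is the derivative of \<open>M\<^sub>n\<close> at \<open>q = 1\<close>. Differentiating the system gives
a recurrence that is solved by induction (\<open>tot_closed_form\<close>).

The number of avoiding words is \<open>M\<^sub>n(0)\<close>. At \<open>q = 0\<close> the system yields the generating function
\<open>x (1 - 2x) / ((1 - 2x)\<^sup>2 - 2x\<^sup>3) = z / (1 - u)\<close>, where \<open>y = x / (1 - x)\<close>, \<open>z = x / (1 - 2x)\<close> and
\<open>u = y z (x + z) = 2x\<^sup>3 / (1 - 2x)\<^sup>2\<close> (\<open>avoider_fps_eq\<close>). Expanding the geometric series in \<open>u\<close> gives the
sum over \<open>p\<close>, expanding \<open>(x + z)\<^sup>p\<close> gives the sum over \<open>r\<close>, and expanding the remaining product of powers
of \<open>y\<close> and \<open>z\<close>, a series in \<open>y\<close> because \<open>z = y / (1 - y)\<close>, gives the sum over the powers \<open>y\<^sup>j\<close>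
(\<open>triple_sum_eq\<close>).\<close>

section \<open>Runs and flattened words\<close>

text \<open>The letters that begin an increasing run can be recognised locally: there is no predecessor, or
the predecessor is larger.\<close>

definition run_start :: "nat list \<Rightarrow> nat \<Rightarrow> bool" where
  "run_start w i \<longleftrightarrow> i < length w \<and> (\<forall>k. i = Suc k \<longrightarrow> w ! i < w ! k)"

lemma sorted_segment_iff:
  assumes "j < length w"
  shows "sorted (segment w i j) \<longleftrightarrow> (\<forall>k. i \<le> k \<and> k < j \<longrightarrow> w ! k \<le> w ! Suc k)"
proof -
  have len: "length (segment w i j) = Suc j - i"
    using assms by (simp add: segment_def)
  have nth: "segment w i j ! k = w ! (i + k)" if "k < Suc j - i" for k
    using assms that by (simp add: segment_def)
  have "sorted (segment w i j) \<longleftrightarrow> (\<forall>k. Suc k < Suc j - i \<longrightarrow> w ! (i + k) \<le> w ! Suc (i + k))"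
    unfolding sorted_iff_nth_Suc len using nth by auto
  also have "\<dots> \<longleftrightarrow> (\<forall>k. i \<le> k \<and> k < j \<longrightarrow> w ! k \<le> w ! Suc k)"
  proof (intro iffI allI impI)
    fix k assume *: "\<forall>k. Suc k < Suc j - i \<longrightarrow> w ! (i + k) \<le> w ! Suc (i + k)" and k: "i \<le> k \<and> k < j"
    have "w ! (i + (k - i)) \<le> w ! Suc (i + (k - i))"
      using *[rule_format, of "k - i"] k by linarith
    then show "w ! k \<le> w ! Suc k" using k by simp
  qed auto
  finally show ?thesis .
qed

text \<open>The longest nondecreasing string from a start position onwards cannot be prolonged to the left,
since nothing or a larger letter precedes it. Conversely, a nondecreasing string preceded by a letter that is
not larger can be prolonged by that letter, so it is not maximal.\<close>

lemma run_start_iff_increasing_run: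
  "run_start w i \<longleftrightarrow> (\<exists>j. increasing_run w i j)"
proof
  assume start: "run_start w i"
  define S where "S = {j. i \<le> j \<and> j < length w \<and> sorted (segment w i j)}"
  have fin: "finite S" by (rule finite_subset[of _ "{..<length w}"]) (auto simp: S_def)
  have "i \<in> S" using start by (auto simp: S_def run_start_def sorted_segment_iff)
  then have S: "Max S \<in> S" using fin by (intro Max_in) auto
  have "increasing_run w i (Max S)"
    unfolding increasing_run_def
  proof (intro conjI allI impI)
    fix i' j'
    assume *: "i' \<le> i \<and> Max S \<le> j' \<and> j' < length w \<and> sorted (segment w i' j')"
    have step: "w ! k \<le> w ! Suc k" if "i' \<le> k" "k < j'" for k
      using * that sorted_segment_iff by blast
    show "i' = i"
    proof (rule ccontr)
      assume "i' \<noteq> i"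
      then obtain k where k: "i = Suc k" "i' \<le> k" using * by (cases i) auto
      with step[of k] * S have "w ! k \<le> w ! i" by (auto simp: S_def)
      with start k show False by (auto simp: run_start_def)
    qed
    with * S have "j' \<in> S" by (auto simp: S_def)
    then show "j' = Max S" using fin * by (meson Max_ge le_antisym)
  qed (use S in \<open>auto simp: S_def\<close>)
  then show "\<exists>j. increasing_run w i j" by blast
next
  assume "\<exists>j. increasing_run w i j"
  then obtain j where ij: "i \<le> j" "j < length w" "sorted (segment w i j)"
    and maximal: "\<And>i' j'. i' \<le> i \<Longrightarrow> j \<le> j' \<Longrightarrow> j' < length w \<Longrightarrow> sorted (segment w i' j')
      \<Longrightarrow> i' = i \<and> j' = j"
    unfolding increasing_run_def by blast
  have "w ! i < w ! k" if k: "i = Suc k" for k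
  proof (rule ccontr)
    assume "\<not> w ! i < w ! k"
    then have "sorted (segment w k j)"
      using ij k sorted_segment_iff[of j w] by (metis Suc_leI le_neq_implies_less not_less)
    with maximal[of k j] ij k show False by auto
  qed
  then show "run_start w i" using ij by (auto simp: run_start_def)
qed

lemma flattened_iff_run_start:
  "flattened w \<longleftrightarrow> (\<forall>i k. run_start w i \<and> run_start w k \<and> i < k \<longrightarrow> w ! i \<le> w ! k)"
  unfolding flattened_def run_start_iff_increasing_run by blast

lemma run_start_snoc:
  assumes "w \<noteq> []"
  shows "run_start (w @ [x]) i \<longleftrightarrow> run_start w i \<or> (i = length w \<and> x < last w)"
  using assms by (auto simp: run_start_def nth_append last_conv_nth less_Suc_eq split: if_splits)

definition run_heads :: "nat list \<Rightarrow> nat set" where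
  "run_heads w = {w ! i |i. run_start w i}"

text \<open>For flattened words this is the first letter of the last run. Taking the maximum avoids having to
single out the last run, and makes the effect of appending a letter immediate.\<close>

definition run_head :: "nat list \<Rightarrow> nat" where
  "run_head w = Max (run_heads w)"

lemma finite_run_heads [simp]: "finite (run_heads w)"
proof (rule finite_subset)
  show "run_heads w \<subseteq> set w" by (auto simp: run_heads_def run_start_def)
qed simp

lemma run_heads_nonempty: "w \<noteq> [] \<Longrightarrow> run_heads w \<noteq> {}"
  by (auto simp: run_heads_def run_start_def)

lemma run_heads_snoc:
  assumes "w \<noteq> []"
  shows "run_heads (w @ [x]) = (if x < last w then insert x (run_heads w) else run_heads w)"
proof -
  have "(w @ [x]) ! i = w ! i" if "run_start w i" for i
    using that by (simp add: run_start_def nth_append)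
  then show ?thesis
    unfolding run_heads_def run_start_snoc[OF assms]
    by (force simp: nth_append)
qed

lemma run_head_snoc:
  assumes "w \<noteq> []"
  shows "run_head (w @ [x]) = (if x < last w then max x (run_head w) else run_head w)"
  using assms by (simp add: run_head_def run_heads_snoc run_heads_nonempty)

text \<open>Only an appended descent starts a new run; its first letter has to be compared with all earlier
first letters, that is, with their maximum.\<close>

lemma flattened_snoc:
  assumes "w \<noteq> []"
  shows "flattened (w @ [x]) \<longleftrightarrow> flattened w \<and> (x < last w \<longrightarrow> run_head w \<le> x)"
proof -
  have old: "(w @ [x]) ! i = w ! i" if "run_start w i" for i
    using that by (simp add: run_start_def nth_append)
  have lt: "i < length w" if "run_start w i" for i
    using that by (simp add: run_start_def)
  have "run_head w \<le> x \<longleftrightarrow> (\<forall>i. run_start w i \<longrightarrow> w ! i \<le> x)"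
  proof -
    have "run_head w \<le> x \<longleftrightarrow> (\<forall>a\<in>run_heads w. a \<le> x)"
      by (simp add: run_head_def run_heads_nonempty[OF assms])
    then show ?thesis by (auto simp: run_heads_def)
  qed
  then show ?thesis
    unfolding flattened_iff_run_start run_start_snoc[OF assms]
    using old lt by (fastforce simp: nth_append)
qed

lemma catalan_word_snoc:
  assumes "w \<noteq> []"
  shows "catalan_word (w @ [x]) \<longleftrightarrow> catalan_word w \<and> 1 \<le> x \<and> x \<le> Suc (last w)"
proof -
  have step: "(\<forall>i<length w. P i) \<longleftrightarrow> (\<forall>i. Suc i < length w \<longrightarrow> P i) \<and> P (length w - 1)" for P
    using assms by (metis Suc_lessD Suc_pred' diff_less length_greater_0_conv less_antisym lessI zero_less_one not_less_eq)
  show ?thesis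
    using assms unfolding catalan_word_def
    by (auto simp: step nth_append last_conv_nth cong: conj_cong)
qed

lemma catalan_word_singleton: "catalan_word [x] \<longleftrightarrow> x = 1"
  by (auto simp: catalan_word_def)

lemma run_start_singleton: "run_start [x] i \<longleftrightarrow> i = 0"
  by (auto simp: run_start_def)

lemma flattened_singleton: "flattened [x]"
  by (auto simp: flattened_iff_run_start run_start_singleton)

lemma run_head_singleton: "run_head [x] = x"
  by (simp add: run_head_def run_heads_def run_start_singleton)

lemma run_head_le_last: "flattened w \<Longrightarrow> w \<noteq> [] \<Longrightarrow> run_head w \<le> last w"
proof (induction w rule: rev_induct)
  case (snoc x w)
  then show ?case
    by (cases "w = []") (auto simp: run_head_singleton run_head_snoc flattened_snoc)
qed simp

lemma run_head_pos: "catalan_word w \<Longrightarrow> 1 \<le> run_head w"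
proof (induction w rule: rev_induct)
  case (snoc x w)
  then show ?case
    by (cases "w = []") (auto simp: run_head_singleton run_head_snoc catalan_word_snoc catalan_word_singleton)
qed (simp add: catalan_word_def)

section \<open>The generating tree of flattened Catalan words\<close>

abbreviation "FCW \<equiv> flattened_catalan_words"

lemma FCW_0: "FCW 0 = {}"
  by (auto simp: flattened_catalan_words_def catalan_word_def)

lemma FCW_1: "FCW (Suc 0) = {[1]}"
  by (auto simp: flattened_catalan_words_def length_Suc_conv flattened_singleton catalan_word_singleton)

lemma FCW_run_head:
  assumes "w \<in> FCW n"
  shows "w \<noteq> []" "1 \<le> run_head w" "run_head w \<le> last w"
  using assms run_head_le_last run_head_pos
  by (auto simp: flattened_catalan_words_def catalan_word_def)

text \<open>With \<open>h = run_head w\<close> and \<open>l = last w\<close>, the Catalan bounds \<open>1 \<le> x \<le> l + 1\<close> and the condition \<open>h \<le> x\<close> for descents \<open>x < l\<close> merge into one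
interval because \<open>1 \<le> h \<le> l\<close>.\<close>

lemma snoc_mem_FCW:
  assumes "w \<noteq> []"
  shows "w @ [x] \<in> FCW (Suc n) \<longleftrightarrow> w \<in> FCW n \<and> x \<in> {run_head w..Suc (last w)}"
  using assms run_head_le_last[of w] run_head_pos[of w]
  by (auto simp: flattened_catalan_words_def flattened_snoc catalan_word_snoc)

text \<open>The hypothesis \<open>n \<ge> 1\<close> is essential: the empty word is not a Catalan word, so the word \<open>1\<close> of
length \<open>1\<close> has no parent.\<close>

lemma FCW_Suc:
  assumes "n \<ge> 1"
  shows "FCW (Suc n) = (\<lambda>(w, x). w @ [x]) ` (SIGMA w:FCW n. {run_head w..Suc (last w)})"
proof (intro equalityI subsetI)
  fix v assume v: "v \<in> FCW (Suc n)"
  then have "length v = Suc n" by (simp add: flattened_catalan_words_def)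
  then obtain w x where wx: "v = w @ [x]" "length w = n"
    by (metis length_Suc_conv_rev)
  then have "w \<noteq> []" using assms by auto
  from snoc_mem_FCW[OF this] v wx show "v \<in> (\<lambda>(w, x). w @ [x]) ` (SIGMA w:FCW n. {run_head w..Suc (last w)})"
    by force
next
  fix v assume "v \<in> (\<lambda>(w, x). w @ [x]) ` (SIGMA w:FCW n. {run_head w..Suc (last w)})"
  then show "v \<in> FCW (Suc n)" using snoc_mem_FCW FCW_run_head(1) by force
qed

lemma finite_FCW: "finite (FCW n)"
proof (induction n)
  case (Suc n)
  then show ?case by (cases n) (simp_all add: FCW_1 FCW_Suc)
qed (simp add: FCW_0)

lemma sum_FCW_Suc:
  assumes "n \<ge> 1"
  shows "(\<Sum>v\<in>FCW (Suc n). g v) = (\<Sum>w\<in>FCW n. \<Sum>x = run_head w..Suc (last w). g (w @ [x]))"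
proof -
  have "inj_on (\<lambda>(w, x). w @ [x]) (SIGMA w:FCW n. {run_head w..Suc (last w)})"
    by (auto simp: inj_on_def)
  then show ?thesis
    by (simp add: FCW_Suc[OF assms] sum.reindex sum.Sigma finite_FCW case_prod_unfold del: sum.cl_ivl_Suc)
qed

section \<open>Occurrences of 121 along the tree\<close>

definition occ121 :: "nat list \<Rightarrow> nat" where
  "occ121 w = card (occurrences [1, 2, 1] w)"

definition ends_in_ascent :: "nat list \<Rightarrow> bool" where
  "ends_in_ascent w \<longleftrightarrow> (\<exists>u a b. w = u @ [a, b] \<and> a < b)"

lemma order_isomorphic_121:
  "order_isomorphic u [1, 2, 1] \<longleftrightarrow> (\<exists>a b. u = [a, b, a] \<and> a < b)"
proof
  assume *: "order_isomorphic u [1, 2, 1]"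
  then have "length u = 3" by (simp add: order_isomorphic_def)
  then obtain a b c where u: "u = [a, b, c]" by (auto simp: length_Suc_conv numeral_3_eq_3)
  have "\<forall>i<3. \<forall>j<3. u ! i < u ! j \<longleftrightarrow> [1, 2, 1::nat] ! i < [1, 2, 1] ! j"
    using * u by (simp add: order_isomorphic_def)
  from this[rule_format, of 0 1] this[rule_format, of 0 2] this[rule_format, of 2 0]
  show "\<exists>a b. u = [a, b, a] \<and> a < b" by (auto simp: u)
qed (auto simp: order_isomorphic_def less_Suc_eq)

text \<open>A new occurrence has to use the appended letter \<open>x\<close>, hence consists of the last three letters.\<close>

lemma occurrences_snoc:
  "occurrences [1, 2, 1] (w @ [x]) = occurrences [1, 2, 1] w \<union>
     (if \<exists>u b. w = u @ [x, b] \<and> x < b then {length w - 2} else {})" (is "?L = ?R")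
proof (rule set_eqI)
  fix i
  have *: "i \<in> occurrences [1, 2, 1] v \<longleftrightarrow>
      i + 3 \<le> length v \<and> (\<exists>a b. take 3 (drop i v) = [a, b, a] \<and> a < b)" for v
    unfolding occurrences_def order_isomorphic_121 by (simp add: numeral_3_eq_3)
  \<comment> \<open>The old positions, the one new position, and the positions too far to the right.\<close>
  consider "i + 3 \<le> length w" | "i + 3 = Suc (length w)" | "i + 3 > Suc (length w)" by linarith
  then show "i \<in> ?L \<longleftrightarrow> i \<in> ?R"
  proof cases
    case 1
    then show ?thesis by (auto simp: * simp del: One_nat_def)
  next
    case 2
    then have len: "length (drop i w) = 2" by simp
    then obtain a b where ab: "drop i w = [a, b]"
      unfolding numeral_2_eq_2 length_Suc_conv length_0_conv by blast
    then have w: "w = take i w @ [a, b]" by (metis append_take_drop_id)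
    have "(\<exists>u b. w = u @ [x, b] \<and> x < b) \<longleftrightarrow> a = x \<and> a < b"
      by (subst (1) w) (metis append1_eq_conv append_Cons append_Nil append_assoc w)
    moreover have "i \<in> ?L \<longleftrightarrow> a = x \<and> a < b"
      using 2 ab by (auto simp: * simp del: One_nat_def)
    moreover have "i \<notin> occurrences [1, 2, 1] w" using 2 by (simp add: * del: One_nat_def)
    moreover have "i = length w - 2" using 2 by simp
    ultimately show ?thesis by auto
  next
    case 3
    then show ?thesis by (auto simp: * simp del: One_nat_def)
  qed
qed

lemma finite_occurrences: "finite (occurrences \<tau> w)"
  by (rule finite_subset[of _ "{..length w}"]) (auto simp: occurrences_def)

text \<open>In a Catalan word a final ascent rises by exactly \<open>1\<close>, so \<open>x\<close> equals the letter before the final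
ascent if and only if it is one less than the last letter.\<close>

lemma occ121_snoc:
  assumes "catalan_word w"
  shows "occ121 (w @ [x]) = occ121 w + (if ends_in_ascent w \<and> Suc x = last w then 1 else 0)"
proof -
  have ascent: "b = Suc a" if "w = u @ [a, b]" "a < b" for u a b
  proof -
    have "catalan_word ((u @ [a]) @ [b])" using assms that by simp
    then have "b \<le> Suc a" using catalan_word_snoc[of "u @ [a]" b] by simp
    then show ?thesis using that by simp
  qed
  have "(\<exists>u b. w = u @ [x, b] \<and> x < b) \<longleftrightarrow> ends_in_ascent w \<and> Suc x = last w"
    unfolding ends_in_ascent_def using ascent by fastforce
  moreover have "length w - 2 \<notin> occurrences [1, 2, 1] w"
    by (auto simp: occurrences_def)
  ultimately show ?thesis
    unfolding occ121_def occurrences_snoc by (auto simp: finite_occurrences)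
qed


section \<open>A linear system for the weight distribution\<close>

definition slack :: "nat list \<Rightarrow> nat" where
  "slack w = last w - run_head w"

definition weight_sum :: "nat \<Rightarrow> real \<Rightarrow> real" where
  "weight_sum n q = (\<Sum>w\<in>FCW n. q ^ occ121 w)"

definition slack_sum :: "nat \<Rightarrow> real \<Rightarrow> real" where
  "slack_sum n q = (\<Sum>w\<in>FCW n. real (slack w) * q ^ occ121 w)"

text \<open>The split according to the effect of the new letter: a descent, a repeated letter, an ascent.\<close>

lemma sum_letters:
  fixes g :: "nat \<Rightarrow> real"
  assumes "a \<le> b"
  shows "(\<Sum>x = a..Suc b. g x) = (\<Sum>x = a..<b. g x) + g b + g (Suc b)"
  using assms by (simp add: sum.last_plus algebra_simps atLeastLessThanSuc_atLeastAtMost[symmetric])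

lemma FCW_catalan: "w \<in> FCW n \<Longrightarrow> catalan_word w"
  by (simp add: flattened_catalan_words_def)

text \<open>This guarantees that after a final ascent the letter \<open>last w - 1\<close>, which creates an occurrence
of \<open>121\<close>, is among the letters that may be appended.\<close>

lemma ascent_run_head:
  assumes "w \<in> FCW n" "ends_in_ascent w"
  shows "run_head w < last w"
proof -
  obtain u a b where w: "w = (u @ [a]) @ [b]" "a < b"
    using assms(2) by (auto simp: ends_in_ascent_def)
  have "flattened (u @ [a])"
    using assms(1) w flattened_snoc[of "u @ [a]" b] by (simp add: flattened_catalan_words_def)
  then have "run_head (u @ [a]) \<le> a" using run_head_le_last by fastforce
  then show ?thesis using w run_head_snoc[of "u @ [a]" b] by simp
qed

text \<open>There are \<open>slack w + 2\<close> children, all with the weight of \<open>w\<close>, except that after an ascent the child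
for \<open>x = last w - 1\<close> has its weight multiplied by \<open>q\<close>.\<close>

lemma sum_children_weight:
  fixes q :: real
  assumes w: "w \<in> FCW n"
  shows "(\<Sum>x = run_head w..Suc (last w). q ^ occ121 (w @ [x])) =
    (real (slack w) + 2) * q ^ occ121 w + (if ends_in_ascent w then (q - 1) * q ^ occ121 w else 0)"
proof -
  have "(\<Sum>x = run_head w..Suc (last w). q ^ occ121 (w @ [x])) =
    (\<Sum>x = run_head w..Suc (last w). q ^ occ121 w +
       (if x = last w - 1 then if ends_in_ascent w then (q - 1) * q ^ occ121 w else 0 else 0))"
    using FCW_run_head[OF w]
    by (intro sum.cong) (auto simp: occ121_snoc[OF FCW_catalan[OF w]] algebra_simps)
  also have "\<dots> = (real (slack w) + 2) * q ^ occ121 w + (if ends_in_ascent w then (q - 1) * q ^ occ121 w else 0)"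
    using FCW_run_head[OF w] ascent_run_head[OF w]
    by (auto simp: sum.distrib slack_def of_nat_diff Suc_diff_le simp del: sum.cl_ivl_Suc)
  finally show ?thesis .
qed

text \<open>Children by a descent have slack \<open>0\<close>; this includes any child with a new occurrence. The
other two have slacks \<open>d\<close> and \<open>d + 1\<close> and the weight of their parent.\<close>

lemma sum_children_slack_weight:
  fixes q :: real
  assumes w: "w \<in> FCW n"
  shows "(\<Sum>x = run_head w..Suc (last w). real (slack (w @ [x])) * q ^ occ121 (w @ [x])) =
    (2 * real (slack w) + 1) * q ^ occ121 w"
proof -
  note [simp] = FCW_run_head[OF w]
  have "slack (w @ [x]) = 0" if "x \<in> {run_head w..<last w}" for x
    using that by (simp add: slack_def run_head_snoc)
  then show ?thesis
    by (subst sum_letters)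
      (simp_all add: slack_def run_head_snoc occ121_snoc[OF FCW_catalan[OF w]] Suc_diff_le algebra_simps)
qed

text \<open>Every word has a unique child that ends in an ascent, and this child has no new occurrence.
For \<open>n = 0\<close> both sides vanish.\<close>

lemma weight_sum_ascent:
  "(\<Sum>w\<in>FCW (Suc n). if ends_in_ascent w then q ^ occ121 w else 0) = weight_sum n q"
proof (cases n)
  case 0
  then show ?thesis by (simp add: FCW_1 FCW_0 weight_sum_def ends_in_ascent_def)
next
  case (Suc m)
  have "(\<Sum>x = run_head w..Suc (last w). if ends_in_ascent (w @ [x]) then q ^ occ121 (w @ [x]) else 0)
    = q ^ occ121 w" if w: "w \<in> FCW n" for w
  proof -
    note [simp] = FCW_run_head[OF w]
    have "ends_in_ascent (w @ [x]) \<longleftrightarrow> last w < x" for x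
    proof -
      obtain u a where "w = u @ [a]" using FCW_run_head(1)[OF w] by (metis rev_exhaust)
      then show ?thesis by (auto simp: ends_in_ascent_def)
    qed
    then show ?thesis
      by (subst sum_letters) (simp_all add: occ121_snoc[OF FCW_catalan[OF w]])
  qed
  then show ?thesis using Suc by (simp add: sum_FCW_Suc weight_sum_def del: sum.cl_ivl_Suc)
qed

lemma weight_sum_0: "weight_sum 0 q = 0" "slack_sum 0 q = 0"
  by (simp_all add: weight_sum_def slack_sum_def FCW_0)

lemma weight_sum_1: "weight_sum (Suc 0) q = 1"
proof -
  have "occurrences [1, 2, 1] [1] = {}" by (auto simp: occurrences_def)
  then show ?thesis by (simp add: weight_sum_def FCW_1 occ121_def)
qed

lemma weight_sum_Suc_Suc:
  "weight_sum (Suc (Suc n)) q =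
     2 * weight_sum (Suc n) q + slack_sum (Suc n) q + (q - 1) * weight_sum n q"
proof -
  have "weight_sum (Suc (Suc n)) q = (\<Sum>w\<in>FCW (Suc n). (real (slack w) + 2) * q ^ occ121 w +
      (q - 1) * (if ends_in_ascent w then q ^ occ121 w else 0))"
    unfolding weight_sum_def
    by (subst sum_FCW_Suc) (auto intro!: sum.cong simp: sum_children_weight simp del: sum.cl_ivl_Suc)
  also have "\<dots> = 2 * weight_sum (Suc n) q + slack_sum (Suc n) q + (q - 1) * weight_sum n q"
    unfolding sum.distrib sum_distrib_left[symmetric] weight_sum_ascent
    by (simp add: weight_sum_def slack_sum_def sum.distrib sum_distrib_left algebra_simps)
  finally show ?thesis .
qed

lemma slack_sum_Suc: "slack_sum (Suc n) q = 2 * slack_sum n q + weight_sum n q"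
proof (cases n)
  case 0
  then show ?thesis by (simp add: slack_sum_def weight_sum_def FCW_0 FCW_1 slack_def run_head_singleton)
next
  case (Suc m)
  then show ?thesis
    by (simp add: slack_sum_def weight_sum_def sum_FCW_Suc sum_children_slack_weight
        sum.distrib sum_distrib_left algebra_simps del: sum.cl_ivl_Suc)
qed

section \<open>The total number of occurrences\<close>

lemma weight_sum_at_1:
  "weight_sum (Suc n) 1 = (3 ^ n + 1) / 2" "slack_sum (Suc n) 1 = (3 ^ n - 1) / 2"
proof (induction n)
  case 0
  show "weight_sum (Suc 0) 1 = (3 ^ 0 + 1) / 2" "slack_sum (Suc 0) 1 = (3 ^ 0 - 1) / 2"
    by (simp_all add: weight_sum_1 slack_sum_Suc weight_sum_0)
next
  case (Suc n)
  then show "weight_sum (Suc (Suc n)) 1 = (3 ^ Suc n + 1) / 2"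
    "slack_sum (Suc (Suc n)) 1 = (3 ^ Suc n - 1) / 2"
    by (simp_all add: weight_sum_Suc_Suc slack_sum_Suc[of "Suc n"] field_simps)
qed

definition slack_tot :: "nat \<Rightarrow> real" where
  "slack_tot n = (\<Sum>w\<in>FCW n. real (slack w) * real (occ121 w))"

text \<open>The derivative of \<open>q ^ k\<close> at \<open>1\<close> is \<open>k\<close>, so differentiation at \<open>1\<close> turns weights into
numbers of occurrences; the recurrences for the totals are the derivatives of those for the
weighted sums.\<close>

lemma weight_sum_deriv:
  "(weight_sum n has_real_derivative real (tot n [1, 2, 1])) (at 1)"
  unfolding weight_sum_def tot_def occ121_def[symmetric]
  by (auto intro!: derivative_eq_intros)

lemma slack_sum_deriv: "(slack_sum n has_real_derivative slack_tot n) (at 1)"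
  unfolding slack_sum_def slack_tot_def
  by (auto intro!: derivative_eq_intros simp: mult.commute)

lemma tot_Suc_Suc:
  "real (tot (Suc (Suc n)) [1, 2, 1]) =
     2 * real (tot (Suc n) [1, 2, 1]) + slack_tot (Suc n) + weight_sum n 1"
proof (rule DERIV_unique)
  show "(weight_sum (Suc (Suc n)) has_real_derivative real (tot (Suc (Suc n)) [1, 2, 1])) (at 1)"
    by (rule weight_sum_deriv)
  show "(weight_sum (Suc (Suc n)) has_real_derivative
     2 * real (tot (Suc n) [1, 2, 1]) + slack_tot (Suc n) + weight_sum n 1) (at 1)"
    unfolding weight_sum_Suc_Suc[abs_def]
    by (auto intro!: derivative_eq_intros weight_sum_deriv slack_sum_deriv)
qed

lemma slack_tot_Suc: "slack_tot (Suc n) = 2 * slack_tot n + real (tot n [1, 2, 1])"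
proof (rule DERIV_unique)
  show "(slack_sum (Suc n) has_real_derivative slack_tot (Suc n)) (at 1)"
    by (rule slack_sum_deriv)
  show "(slack_sum (Suc n) has_real_derivative 2 * slack_tot n + real (tot n [1, 2, 1])) (at 1)"
    unfolding slack_sum_Suc[abs_def]
    by (auto intro!: derivative_eq_intros weight_sum_deriv slack_sum_deriv)
qed

text \<open>The recurrences couple the totals with \<open>slack_tot\<close>, so closed forms of both are needed for the
induction. The induction starts at length \<open>2\<close>: the formula fails at length \<open>1\<close>, where the total is \<open>0\<close>.\<close>

lemma tot_closed_form:
  "real (tot (m + 2) [1, 2, 1]) = ((real m + 3) * 3 ^ m / 3 + real m - 1) / 4 \<and>
   slack_tot (m + 2) = real m * (3 ^ m / 3 - 1) / 4"
proof (induction m)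
  case 0
  have "tot 0 [1, 2, 1] = 0" "slack_tot 0 = 0" by (simp_all add: tot_def slack_tot_def FCW_0)
  moreover have "real (tot (Suc 0) [1, 2, 1]) = 0"
    by (simp add: tot_def FCW_1 occurrences_def)
  ultimately show ?case
    using tot_Suc_Suc[of 0] slack_tot_Suc[of 0] slack_tot_Suc[of 1]
    by (simp add: numeral_2_eq_2 weight_sum_0)
next
  case (Suc m)
  then show ?case
    using tot_Suc_Suc[of "Suc m"] slack_tot_Suc[of "m + 2"] weight_sum_at_1(1)[of m]
    by (simp add: field_simps)
qed

text \<open>At \<open>q = 0\<close> only the words without occurrences survive, since \<open>0 ^ 0 = 1\<close>.\<close>

lemma num_avoiding_eq_weight_sum: "real (num_avoiding n [1, 2, 1]) = weight_sum n 0"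
proof -
  have "avoids w [1, 2, 1] \<longleftrightarrow> occ121 w = 0" for w
    by (simp add: avoids_def occ121_def finite_occurrences)
  then show ?thesis
    by (simp add: num_avoiding_def weight_sum_def power_0_left sum.If_cases finite_FCW Int_def)
qed


section \<open>The generating function of the avoiding words\<close>

unbundle fps_syntax

definition geo :: "real fps" where "geo = fps_X * inverse (1 - fps_X)"

definition geo2 :: "real fps" where "geo2 = fps_X * inverse (1 - 2 * fps_X)"

text \<open>With \<open>geo\<close> and \<open>geo2\<close> as \<open>y\<close> and \<open>z\<close>, this is the series \<open>u = 2x\<^sup>3 / (1 - 2x)\<^sup>2\<close>. It is written as
a product so that its powers expand into the summands of the triple sum.\<close>

definition ratio :: "real fps" where "ratio = geo * geo2 * (fps_X + geo2)"

lemma geo_mult: "geo * (1 - fps_X) = fps_X"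
  by (simp add: geo_def mult.assoc inverse_mult_eq_1)

lemma geo2_mult: "geo2 * (1 - 2 * fps_X) = fps_X"
  by (simp add: geo2_def mult.assoc inverse_mult_eq_1)

lemma geo_0: "geo $ 0 = 0" and geo2_0: "geo2 $ 0 = 0" and ratio_0: "ratio $ 0 = 0"
  by (simp_all add: geo_def geo2_def ratio_def)

lemma one_minus_X_nz: "(1 - fps_X :: real fps) \<noteq> 0"
  by (auto simp: fps_eq_iff intro!: exI[of _ 0])

lemma one_minus_2X_nz: "(1 - 2 * fps_X :: real fps) \<noteq> 0"
  by (auto simp: fps_eq_iff intro!: exI[of _ 0])

definition avoider_fps :: "real fps" where
  "avoider_fps = Abs_fps (\<lambda>n. weight_sum n 0)"

text \<open>Writing \<open>A\<close> for the generating function of the avoiding words and \<open>S\<close> for that of their slacks, the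
linear system at \<open>q = 0\<close> becomes \<open>A = x + 2xA + xS - x\<^sup>2A\<close> and \<open>S = 2xS + xA\<close>. Eliminating \<open>S\<close>
gives \<open>A ((1 - 2x)\<^sup>2 - 2x\<^sup>3) = x (1 - 2x)\<close>.\<close>

lemma avoider_fps_eq: "avoider_fps * (1 - ratio) = geo2"
proof -
  let ?X = "fps_X :: real fps"
  define S where "S = Abs_fps (\<lambda>n. slack_sum n 0)"
  have A: "avoider_fps = ?X + ?X * (2 * avoider_fps) + ?X * S - ?X * (?X * avoider_fps)"
  proof (rule fps_ext)
    fix n
    show "avoider_fps $ n =
      (?X + ?X * (2 * avoider_fps) + ?X * S - ?X * (?X * avoider_fps)) $ n"
    proof (cases n)
      case 0
      then show ?thesis by (simp add: avoider_fps_def weight_sum_0)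
    next
      case (Suc m)
      then show ?thesis
        by (cases m) (simp_all add: avoider_fps_def S_def weight_sum_0 weight_sum_1
            weight_sum_Suc_Suc numeral_fps_const)
    qed
  qed
  have S: "S = ?X * (2 * S) + ?X * avoider_fps"
  proof (rule fps_ext)
    fix n
    show "S $ n = (?X * (2 * S) + ?X * avoider_fps) $ n"
      by (cases n) (simp_all add: avoider_fps_def S_def weight_sum_0 slack_sum_Suc numeral_fps_const)
  qed
  have "(ratio * (1 - 2 * ?X)^2) * (1 - ?X) = (2 * ?X ^ 3) * (1 - ?X)"
  proof -
    have "(ratio * (1 - 2 * ?X)^2) * (1 - ?X) =
        (geo * (1 - ?X)) * (geo2 * (1 - 2 * ?X)) * (?X * (1 - 2 * ?X) + geo2 * (1 - 2 * ?X))"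
      unfolding ratio_def by algebra
    also have "\<dots> = (2 * ?X ^ 3) * (1 - ?X)" unfolding geo_mult geo2_mult by algebra
    finally show ?thesis .
  qed
  then have ratio: "ratio * (1 - 2 * ?X)^2 = 2 * ?X ^ 3" using one_minus_X_nz by simp
  have A': "avoider_fps * (1 - 2 * ?X + ?X ^ 2) = ?X + ?X * S" using A by algebra
  have S': "S * (1 - 2 * ?X) = ?X * avoider_fps" using S by algebra
  have "(avoider_fps * (1 - ratio)) * (1 - 2 * ?X)^2 =
      avoider_fps * (1 - 2 * ?X)^2 - avoider_fps * (ratio * (1 - 2 * ?X)^2)" by algebra
  also have "\<dots> = (avoider_fps * (1 - 2 * ?X + ?X ^ 2)) * (1 - 2 * ?X) - ?X * (?X * avoider_fps)"
    unfolding ratio by algebra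
  also have "\<dots> = ?X * (1 - 2 * ?X) + ?X * (S * (1 - 2 * ?X)) - ?X * (?X * avoider_fps)"
    unfolding A' by algebra
  also have "\<dots> = (geo2 * (1 - 2 * ?X)) * (1 - 2 * ?X)" unfolding S' geo2_mult by algebra
  finally have "(avoider_fps * (1 - ratio)) * (1 - 2 * ?X)^2 = geo2 * (1 - 2 * ?X)^2"
    by (simp only: power2_eq_square mult_ac)
  then show ?thesis using one_minus_2X_nz by simp
qed

text \<open>The expansion of \<open>z / (1 - u)\<close> may be truncated after \<open>u ^ n\<close>, because \<open>u ^ Suc n\<close> has no terms
of degree at most \<open>n\<close>.\<close>

lemma weight_sum_at_0: "weight_sum n 0 = (\<Sum>p = 0..n. (geo2 * ratio ^ p) $ n)"
proof -
  have "avoider_fps * (1 - ratio ^ Suc n) = avoider_fps * (1 - ratio) * (\<Sum>p\<le>n. ratio ^ p)"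
    by (simp only: one_diff_power_eq mult.assoc lessThan_Suc_atMost)
  also have "\<dots> = (\<Sum>p = 0..n. geo2 * ratio ^ p)"
    by (simp add: avoider_fps_eq sum_distrib_left atLeast0AtMost)
  finally have eq: "avoider_fps = (\<Sum>p = 0..n. geo2 * ratio ^ p) + avoider_fps * ratio ^ Suc n"
    by (simp add: algebra_simps)
  have "(avoider_fps * ratio ^ Suc n) $ n = 0"
    unfolding fps_mult_nth using startsby_zero_power_prefix[OF ratio_0, of "Suc n"]
    by (intro sum.neutral) auto
  then have "avoider_fps $ n = (\<Sum>p = 0..n. (geo2 * ratio ^ p) $ n)"
    by (subst eq) (simp add: fps_sum_nth)
  then show ?thesis by (simp add: avoider_fps_def)
qed

section \<open>The triple sum\<close>

lemma geo2_mult_geo: "geo2 * (1 - geo) = geo"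
proof -
  have "(geo2 * (1 - geo)) * ((1 - 2 * fps_X) * (1 - fps_X)) =
      (geo2 * (1 - 2 * fps_X)) * ((1 - fps_X) - geo * (1 - fps_X))"
    by algebra
  also have "\<dots> = (geo * (1 - fps_X)) * (1 - 2 * fps_X)"
    unfolding geo_mult geo2_mult by algebra
  finally have "(geo2 * (1 - geo)) * ((1 - 2 * fps_X) * (1 - fps_X)) = geo * ((1 - 2 * fps_X) * (1 - fps_X))"
    by (simp only: mult_ac)
  then show ?thesis using one_minus_X_nz one_minus_2X_nz by simp
qed

text \<open>Substituting \<open>x / (1 - x)\<close> into itself gives \<open>x / (1 - 2x)\<close>. This is what lets powers of the
latter be expanded in powers of the former.\<close>

lemma geo_compose_geo: "geo oo geo = geo2"
proof -
  have "(geo * (1 - fps_X)) oo geo = fps_X oo geo" by (simp add: geo_mult)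
  then have *: "(geo oo geo) * (1 - geo) = geo"
    by (simp add: fps_compose_mult_distrib geo_0 fps_compose_sub_distrib)
  \<comment> \<open>The same equation characterises \<open>geo2\<close>, and \<open>1 - geo\<close> can be cancelled.\<close>
  have "1 - geo \<noteq> 0" using geo_0 by (metis diff_zero fps_one_nth fps_sub_nth fps_zero_nth one_neq_zero)
  with * geo2_mult_geo show ?thesis by (metis mult_right_cancel)
qed

definition binomial_column :: "nat \<Rightarrow> real fps" where
  "binomial_column q = Abs_fps (\<lambda>m. real (m choose q))"

text \<open>Pascal's rule says that passing from one column of Pascal's triangle to the next multiplies its
generating function by \<open>x / (1 - x)\<close>.\<close>

lemma binomial_column_mult: "binomial_column q * (1 - fps_X) = geo ^ q"
proof (induction q)
  case 0
  show ?case
    by (rule fps_ext) (simp add: binomial_column_def algebra_simps)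
next
  case (Suc q)
  have "binomial_column (Suc q) * (1 - fps_X) = fps_X * binomial_column q"
  proof (rule fps_ext)
    fix n show "(binomial_column (Suc q) * (1 - fps_X)) $ n = (fps_X * binomial_column q) $ n"
      by (cases n) (simp_all add: binomial_column_def algebra_simps)
  qed
  also have "\<dots> = geo * (binomial_column q * (1 - fps_X))"
    by (subst geo_mult[symmetric]) (simp only: mult_ac)
  finally show ?case by (simp add: Suc)
qed

text \<open>Both indices have to be positive: with truncated subtraction the right-hand side is \<open>1\<close> for
\<open>j = 1\<close>, \<open>m = 0\<close> and for \<open>j = 0\<close>, \<open>m \<ge> 1\<close>, where the coefficient is \<open>0\<close>.\<close>

lemma geo_power_nth:
  assumes "j \<ge> 1" "m \<ge> 1"
  shows "(geo ^ j) $ m = real ((m - 1) choose (j - 1))"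
proof -
  have "geo ^ j = geo ^ (j - 1) * geo" using assms by (metis Suc_pred' less_eq_Suc_le One_nat_def power_Suc2)
  also have "\<dots> = fps_X * binomial_column (j - 1)"
    unfolding binomial_column_mult[symmetric] by (subst (2) geo_mult[symmetric]) (simp only: mult_ac)
  finally show ?thesis using assms by (simp add: binomial_column_def)
qed

text \<open>The series \<open>x\<^sup>p\<^sup>+\<^sup>1 x\<^sup>q / (1 - x)\<^sup>q\<^sup>+\<^sup>1\<close>, with \<open>y = x / (1 - x)\<close> substituted for \<open>x\<close>, is
\<open>y\<^sup>p (y / (1 - y))\<^sup>q\<^sup>+\<^sup>1\<close>, and \<open>y / (1 - y) = z\<close>.\<close>

lemma shifted_column_compose:
  "(fps_X ^ Suc p * binomial_column q) oo geo = geo2 * geo ^ p * geo2 ^ q"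
proof -
  have "(binomial_column q * (1 - fps_X)) oo geo = geo ^ q oo geo"
    by (simp add: binomial_column_mult)
  then have *: "(binomial_column q oo geo) * (1 - geo) = geo2 ^ q"
    by (simp add: fps_compose_mult_distrib fps_compose_power[OF geo_0, symmetric] geo_0
        fps_compose_sub_distrib geo_compose_geo)
  have "(fps_X ^ Suc p * binomial_column q) oo geo = geo ^ Suc p * (binomial_column q oo geo)"
    by (simp add: fps_compose_mult_distrib fps_compose_power[symmetric] geo_0 del: power_Suc)
  also have "\<dots> = geo ^ p * geo * (binomial_column q oo geo)"
    by (simp add: mult_ac)
  also have "\<dots> = geo ^ p * (geo2 * (1 - geo)) * (binomial_column q oo geo)"
    by (simp only: geo2_mult_geo)
  also have "\<dots> = geo2 * geo ^ p * ((binomial_column q oo geo) * (1 - geo))"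
    by (simp only: mult_ac)
  finally show ?thesis by (simp only: *)
qed

text \<open>The coefficient of degree \<open>n\<close> involves \<open>b ^ i\<close> for \<open>i \<le> n\<close> only, because \<open>b ^ i\<close> starts in
degree at least \<open>i\<close>; the same upper bound then serves all coefficients that enter the product
with \<open>c\<close>.\<close>

lemma mult_compose_nth:
  fixes a b c :: "'a::comm_ring_1 fps"
  assumes "b $ 0 = 0"
  shows "(c * (a oo b)) $ n = (\<Sum>i=0..n. a $ i * (c * b ^ i) $ n)"
proof -
  have "(a oo b) $ m = (\<Sum>i=0..n. a $ i * (b ^ i) $ m)" if "m \<le> n" for m
    unfolding fps_compose_nth
    using that startsby_zero_power_prefix[OF assms] by (intro sum.mono_neutral_left) auto
  then have "(c * (a oo b)) $ n = (\<Sum>k=0..n. \<Sum>i=0..n. a $ i * (c $ k * (b ^ i) $ (n - k)))"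
    by (simp add: fps_mult_nth sum_distrib_left mult_ac)
  also have "\<dots> = (\<Sum>i=0..n. a $ i * (c * b ^ i) $ n)"
    by (subst sum.swap) (simp add: fps_mult_nth sum_distrib_left)
  finally show ?thesis .
qed

text \<open>Truncated subtraction is harmless here. For \<open>2 * p < j\<close> all the differences are true ones; otherwise
\<open>j - p - 1 < p \<le> 2 * p - r\<close>, and both sides vanish.\<close>

lemma triple_summand:
  assumes "r \<le> p" "1 \<le> j" "j \<le> n"
  shows "real ((j - p - 1 choose (2 * p - r)) * ((n - r - 1) choose (j - 1))) =
    (fps_X ^ Suc p * binomial_column (2 * p - r)) $ j * (fps_X ^ r * geo ^ j) $ n"
proof (cases "2 * p < j")
  case True
  then have "r < n" using assms by linarith
  with True assms show ?thesis
    by (simp add: fps_X_power_mult_nth binomial_column_def geo_power_nth del: power_Suc)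
next
  case False
  then have "j - p - 1 < 2 * p - r" using assms by linarith
  with False assms show ?thesis
    by (simp add: fps_X_power_mult_nth binomial_column_def binomial_eq_0 del: power_Suc)
qed

text \<open>Summing over \<open>j\<close> is composition with \<open>y = x / (1 - x)\<close> and gives \<open>x\<^sup>r z y\<^sup>p z\<^sup>2\<^sup>p\<^sup>-\<^sup>r\<close>; summing over \<open>r\<close> is
then the binomial theorem for \<open>(x + z)\<^sup>p\<close>.\<close>

lemma triple_sum_eq:
  "real (\<Sum>j = 1..n. \<Sum>p = 0..(j - 1) div 2. \<Sum>r = 0..p.
      (p choose r) * ((j - p - 1) choose (2 * p - r)) * ((n - r - 1) choose (j - 1))) =
    (\<Sum>p = 0..n. (geo2 * ratio ^ p) $ n)" (is "?L = _")
proof -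
  let ?t = "\<lambda>j p r. (p choose r) * ((j - p - 1) choose (2 * p - r)) * ((n - r - 1) choose (j - 1))"
  \<comment> \<open>For larger \<open>p\<close> the second binomial coefficient vanishes, so the range of \<open>p\<close> can be made independent of \<open>j\<close>.\<close>
  have extend: "(\<Sum>p = 0..(j - 1) div 2. \<Sum>r = 0..p. ?t j p r) = (\<Sum>p = 0..n. \<Sum>r = 0..p. ?t j p r)"
    if "j \<in> {1..n}" for j
  proof (rule sum.mono_neutral_left)
    show "{0..(j - 1) div 2} \<subseteq> {0..n}" using that by auto
    show "\<forall>p\<in>{0..n} - {0..(j - 1) div 2}. (\<Sum>r = 0..p. ?t j p r) = 0"
      using that by (intro ballI sum.neutral) (auto intro!: binomial_eq_0)
  qed simp
  have "?L = real (\<Sum>j = 1..n. \<Sum>p = 0..n. \<Sum>r = 0..p. ?t j p r)"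
    by (simp only: extend cong: sum.cong)
  also have "\<dots> = (\<Sum>j = 1..n. \<Sum>p = 0..n. \<Sum>r = 0..p. real (p choose r) *
      ((fps_X ^ Suc p * binomial_column (2 * p - r)) $ j * (fps_X ^ r * geo ^ j) $ n))"
    unfolding of_nat_sum
  proof (intro sum.cong refl)
    fix j p r :: nat assume "j \<in> {1..n}" "r \<in> {0..p}"
    then show "real (?t j p r) = real (p choose r) *
      ((fps_X ^ Suc p * binomial_column (2 * p - r)) $ j * (fps_X ^ r * geo ^ j) $ n)"
      using triple_summand[of r p j n] by (simp add: mult.assoc del: power_Suc)
  qed
  also have "\<dots> = (\<Sum>p = 0..n. \<Sum>r = 0..p. real (p choose r) * (\<Sum>j = 1..n.
      (fps_X ^ Suc p * binomial_column (2 * p - r)) $ j * (fps_X ^ r * geo ^ j) $ n))"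
    by (subst sum.swap, rule sum.cong[OF refl], subst sum.swap) (simp only: sum_distrib_left)
  also have "\<dots> = (\<Sum>p = 0..n. \<Sum>r = 0..p. real (p choose r) *
      (fps_X ^ r * (geo2 * geo ^ p * geo2 ^ (2 * p - r))) $ n)"
  proof -
    have "(\<Sum>j = 1..n. (fps_X ^ Suc p * binomial_column q) $ j * (fps_X ^ r * geo ^ j) $ n) =
      (fps_X ^ r * (geo2 * geo ^ p * geo2 ^ q)) $ n" for p q r
      unfolding shifted_column_compose[symmetric] mult_compose_nth[OF geo_0]
      by (simp add: sum.atLeast_Suc_atMost mult.assoc)
    then show ?thesis by (simp only:)
  qed
  also have "\<dots> = (\<Sum>p = 0..n. (geo2 * ratio ^ p) $ n)"
  proof (intro sum.cong refl)
    fix p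
    have "geo2 * ratio ^ p = (\<Sum>r = 0..p. of_nat (p choose r) * (fps_X ^ r * (geo2 * geo ^ p * (geo2 ^ p * geo2 ^ (p - r)))))"
      unfolding ratio_def power_mult_distrib binomial_ring
      by (simp add: sum_distrib_left atLeast0AtMost mult_ac)
    also have "\<dots> = (\<Sum>r = 0..p. of_nat (p choose r) * (fps_X ^ r * (geo2 * geo ^ p * geo2 ^ (2 * p - r))))"
      by (intro sum.cong refl) (simp add: power_add[symmetric] mult_2)
    finally show "(\<Sum>r = 0..p. real (p choose r) * (fps_X ^ r * (geo2 * geo ^ p * geo2 ^ (2 * p - r))) $ n) =
       (geo2 * ratio ^ p) $ n"
      by (simp add: fps_sum_nth fps_of_nat[symmetric])
  qed
  finally show ?thesis .
qed

theorem corollary3p2: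
  shows "(\<forall>n::nat. n \<ge> 2 \<longrightarrow>
            real (tot n [1, 2, 1]) =
              ((real n + 1) * 3 powi (int n - 3) + real n - 3) / 4) \<and>
         (\<forall>n::nat. n \<ge> 1 \<longrightarrow>
            num_avoiding n [1, 2, 1] =
              (\<Sum>j = 1..n. \<Sum>p = 0..(j - 1) div 2. \<Sum>r = 0..p.
                 (p choose r) * ((j - p - 1) choose (2 * p - r)) * ((n - r - 1) choose (j - 1))))"
proof (intro conjI allI impI)
  fix n :: nat
  assume "n \<ge> 2"
  then obtain m where n: "n = m + 2" by (metis le_add_diff_inverse2)
  have "3 powi (int n - 3) = (3 ^ m / 3 :: real)"
    using power_int_diff[of "3::real" "int m" 1] by (simp add: n)
  then show "real (tot n [1, 2, 1]) = ((real n + 1) * 3 powi (int n - 3) + real n - 3) / 4"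
    using tot_closed_form[of m] by (simp add: n algebra_simps)
next
  fix n :: nat
  assume "n \<ge> 1"
  then have "real (num_avoiding n [1, 2, 1]) = real (\<Sum>j = 1..n. \<Sum>p = 0..(j - 1) div 2. \<Sum>r = 0..p.
      (p choose r) * ((j - p - 1) choose (2 * p - r)) * ((n - r - 1) choose (j - 1)))"
    by (simp only: num_avoiding_eq_weight_sum weight_sum_at_0 triple_sum_eq)
  then show "num_avoiding n [1, 2, 1] = (\<Sum>j = 1..n. \<Sum>p = 0..(j - 1) div 2. \<Sum>r = 0..p.
      (p choose r) * ((j - p - 1) choose (2 * p - r)) * ((n - r - 1) choose (j - 1)))"
    by (simp only: of_nat_eq_iff)
qed

end
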